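(* Let $(Q,\cdot,\backslash,/)$ be a middle Bol loop and let $g_2:Q^2\to Q$ be defined by $g_2(x,y)=x/(yx)$ or $g_2(x,y)=(y\backslash x)/x$. Below each identity is required for all $x,y\in Q$. Consider the identities $$\begin{aligned} (A)&\quad x(x(x(yx)))=(x(x(xy)))x, & (B)&\quad x(x(x(yx)))=((xx)(xy))x,\\ (C)&\quad x(x(x(yx)))=(x((xx)y))x, & (D)&\quad x(x(x(yx)))=((x(xx))y)x,\\ (E)&\quad x(x(x(yx)))=(((xx)x)y)x, & (D')&\quad x(x(x(yx)))=(x^3y)x. \end{aligned}$$ 1. $(Q,\cdot)$ satisfies $(A)$ if and only if $g_2(x,y)=\Big(\big(g_2(x,x(x(xy)))\,x\big)x\Big)x$. 2. $(Q,\cdot)$ satisfies $(B)$ if and only if $g_2(x,y)=\Big(\big(g_2(x,(xx)(xy))\,x\big)x\Big)x$. 3. $(Q,\cdot)$ satisfies $(C)$ if and only if $g_2(x,y)=\Big(\big(g_2(x,x((xx)y))\,x\big)x\Big)x$. 4. The following are equivalent: (a) $(Q,\cdot)$ satisfies $(D)$; (b) $(Q,\cdot)$ satisfies $(E)$; (c) $(Q,\cdot)$ satisfies $(D')$; (d) $g_2(x,y)=\Big(\big(g_2(x,x^3y)\,x\big)x\Big)x$. 5. If $(Q,\cdot)$ satisfies $x(xy)=(xx)y$, then the following are equivalent: $(Q,\cdot)$ satisfies $(A)$; $(Q,\cdot)$ satisfies $(B)$; $(Q,\cdot)$ satisfies $(C)$. 6. If $(Q,\cdot)$ satisfies $x((xx)y)=(x(xx))y$,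 then the following are equivalent: $(Q,\cdot)$ satisfies $(C)$; $(Q,\cdot)$ satisfies $(D)$; $(Q,\cdot)$ satisfies $(E)$. 7. If $(Q,\cdot)$ satisfies $(xx)(xy)=((xx)x)y$, then the following are equivalent: $(Q,\cdot)$ satisfies $(B)$; $(Q,\cdot)$ satisfies $(C)$; $(Q,\cdot)$ satisfies $(D)$. 8. If $(Q,\cdot)$ satisfies $x(xy)=(xx)y$, $x((xx)y)=(x(xx))y$ and $(xx)(xy)=((xx)x)y$, then the following are equivalent: (a) $(Q,\cdot)$ satisfies $(A)$; (b) $(Q,\cdot)$ satisfies $(B)$; (c) $(Q,\cdot)$ satisfies $(C)$; (d) $(Q,\cdot)$ satisfies $(D)$; (e) $(Q,\cdot)$ satisfies $(E)$; (f) $(Q,\cdot)$ satisfies $x^3(yx)=(x^3y)x$. 9. $(Q,\cdot)$ satisfies $x(x(x(x(yx))))=(x(x(x(xy))))x$ if and only if $g_2(x,y)=\big[\big[\big[g_2\big(x,x(x(x(xy)))\big)x\big]x\big]x\big]x$.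
   Context: A loop $(Q,\cdot,\backslash,/)$ is a loop $(Q,\cdot)$ with identity $e$, where $x\backslash y$ is the unique $z$ with $x\cdot z=y$ and $x/y$ is the unique $z$ with $z\cdot y=x$. It is a middle Bol loop if $x((yz)\backslash x)=(x/z)(y\backslash x)$ for all $x,y,z$. In a middle Bol loop the two expressions given for $g_2$ agree. Middle Bol loops are power associative, so $x^3=(xx)x=x(xx)$ is unambiguous. *)

theory Defs
  imports Main
begin

text \<open>
  A loop on the type \<open>'a\<close>. Here \<open>x \<setminus> y\<close> is the unique \<open>z\<close> with \<open>x \<cdot> z = y\<close>,
  and \<open>x \<^bold>/ y\<close> is the unique \<open>z\<close> with \<open>z \<cdot> y = x\<close>.
\<close>

locale loop =
  fixes mult :: "'a \<Rightarrow> 'a \<Rightarrow> 'a"  (infixl \<open>\<cdot>\<close> 70)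
    and e :: 'a
    and ldiv :: "'a \<Rightarrow> 'a \<Rightarrow> 'a"  (infixl \<open>\<setminus>\<close> 70)
    and rdiv :: "'a \<Rightarrow> 'a \<Rightarrow> 'a"  (infixl \<open>\<^bold>'/\<close> 70)
  assumes left_id: "e \<cdot> x = x"
    and right_id: "x \<cdot> e = x"
    and ldiv_unique: "x \<cdot> z = y \<longleftrightarrow> z = x \<setminus> y"
    and rdiv_unique: "z \<cdot> y = x \<longleftrightarrow> z = x \<^bold>/ y"

locale middle_bol_loop = loop +
  assumes middle_bol: "x \<cdot> ((y \<cdot> z) \<setminus> x) = (x \<^bold>/ z) \<cdot> (y \<setminus> x)"

text \<open>
  The cube is bracketed as \<open>(x \<cdot> x) \<cdot> x\<close>; lemma \<open>cube_alt\<close> below shows that in a middle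
  Bol loop the other bracketing gives the same element.
\<close>

definition cube :: "('a \<Rightarrow> 'a \<Rightarrow> 'a) \<Rightarrow> 'a \<Rightarrow> 'a" where
  "cube m x = m (m x x) x"

context
  fixes mult :: "'a \<Rightarrow> 'a \<Rightarrow> 'a"  (infixl \<open>\<cdot>\<close> 70)
begin

definition identity_A :: bool where
  "identity_A \<longleftrightarrow> (\<forall>x y. x \<cdot> (x \<cdot> (x \<cdot> (y \<cdot> x))) = (x \<cdot> (x \<cdot> (x \<cdot> y))) \<cdot> x)"

definition identity_B :: bool where
  "identity_B \<longleftrightarrow> (\<forall>x y. x \<cdot> (x \<cdot> (x \<cdot> (y \<cdot> x))) = ((x \<cdot> x) \<cdot> (x \<cdot> y)) \<cdot> x)"

definition identity_C :: bool where
  "identity_C \<longleftrightarrow> (\<forall>x y. x \<cdot> (x \<cdot> (x \<cdot> (y \<cdot> x))) = (x \<cdot> ((x \<cdot> x) \<cdot> y)) \<cdot> x)"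

definition identity_D :: bool where
  "identity_D \<longleftrightarrow> (\<forall>x y. x \<cdot> (x \<cdot> (x \<cdot> (y \<cdot> x))) = ((x \<cdot> (x \<cdot> x)) \<cdot> y) \<cdot> x)"

definition identity_E :: bool where
  "identity_E \<longleftrightarrow> (\<forall>x y. x \<cdot> (x \<cdot> (x \<cdot> (y \<cdot> x))) = (((x \<cdot> x) \<cdot> x) \<cdot> y) \<cdot> x)"

definition identity_D' :: bool where
  "identity_D' \<longleftrightarrow> (\<forall>x y. x \<cdot> (x \<cdot> (x \<cdot> (y \<cdot> x))) = (cube (\<cdot>) x \<cdot> y) \<cdot> x)"

end

context middle_bol_loop
begin

lemma ldiv_eq_rdiv: "x \<cdot> (z \<setminus> x) = (x \<^bold>/ z) \<cdot> x"
  by (metis middle_bol left_id ldiv_unique)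

lemma mult_ldiv_left: "x \<cdot> ((x \<cdot> z) \<setminus> x) = x \<^bold>/ z"
  by (metis middle_bol right_id ldiv_unique)

lemma mult_ldiv_right: "x \<cdot> ((y \<cdot> x) \<setminus> x) = y \<setminus> x"
  by (metis middle_bol left_id rdiv_unique)

lemma g2_forms_agree: "x \<^bold>/ (y \<cdot> x) = (y \<setminus> x) \<^bold>/ x"
  using ldiv_eq_rdiv[of x "y \<cdot> x"] mult_ldiv_right[of x y] by (metis rdiv_unique)

lemma inverses_agree: "e \<^bold>/ x = x \<setminus> e"
  using ldiv_eq_rdiv[of e x] by (simp add: left_id right_id)

lemma rdiv_inverse: "x \<^bold>/ (x \<setminus> e) = x \<cdot> x"
  using mult_ldiv_left[of x "x \<setminus> e"] by (metis ldiv_unique left_id)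

lemma ldiv_inverse: "(x \<setminus> e) \<setminus> x = x \<cdot> x"
  using mult_ldiv_right[of x "x \<setminus> e"]
  by (metis inverses_agree rdiv_unique ldiv_unique left_id)

lemma cube_alt: "cube (\<cdot>) x = x \<cdot> (x \<cdot> x)"
  using ldiv_eq_rdiv[of x "x \<setminus> e"] rdiv_inverse ldiv_inverse by (simp add: cube_def)

end

end

theory Submission
  imports Defs
begin

text \<open>
  Write \<open>x\<^sup>-\<close> for the inverse of \<open>x\<close>. For a fixed \<open>x\<close> the map \<open>t \<mapsto> x / t\<close> is injective, and
  in a middle Bol loop it turns left multiplication by \<open>x\<close> into right division by \<open>x\<close>:
  \<open>x / (x t) = (x / t) / x\<close> (\<open>rdiv_prod_left\<close>). Applied to an identity
  \<open>x(x(x(y x))) = w x\<close> it gives \<open>(((x / (y x)) / x) / x) / x = x / (w x)\<close>, and since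
  \<open>x / (y x) = g\<^sub>2(x, y)\<close> and \<open>x / (w x) = g\<^sub>2(x, w)\<close>, this is the criterion for \<open>g\<^sub>2\<close>. Every
  criterion of the theorem is of this form, with three or four factors \<open>x\<close> on the left, and most of
  the remaining equivalences only rebracket one side, or use that both bracketings of \<open>x\<^sup>3\<close> agree.

  The exception is the equivalence of (C) with (B) and (D) under the law \<open>x\<^sup>2(x y) = x\<^sup>3 y\<close>, because
  this law does not mention the element \<open>x(x\<^sup>2 y)\<close> of (C). It rests on the fact that, together with
  the law, either of (C) and (D) forces \<open>x(x y) = x\<^sup>2 y\<close> (\<open>left_alternative\<close>), after which all
  bracketings agree. The reason is as follows.

  The law amounts to \<open>(z x)x\<^sup>-\<^sup>2 = z x\<^sup>-\<close> (\<open>prod_recip_square\<close>); in particular right multiplication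
  by a square is inverted by right multiplication by its inverse. Hence division by a square
  is multiplication by its inverse, and (C) or (D), evaluated at elements built from \<open>x\<close> and a
  square \<open>u\<close>, yields
  \<open>(u x)x\<^sup>- = u\<close> (\<open>square_left_factor_from_C\<close>, \<open>square_left_factor_from_D\<close>). Now all divisions that
  involve a square are multiplications by inverses, so the middle Bol law based at a square becomes
  the Moufang law for that square. Computing \<open>(x y)(x\<^sup>- y)\<close> in two ways then shows that the loop is
  flexible (\<open>recip_flexible\<close>, \<open>flexible\<close>). In a flexible loop the common left-hand side
  \<open>x(x(x(y x)))\<close> is \<open>(x(x(x y)))x\<close>, and cancelling in (C) or (D) leaves the left alternative law.
\<close>

section \<open>Loops and inverses in middle Bol loops\<close>

context loop
begin

lemma mult_ldiv [simp]: "x \<cdot> (x \<setminus> y) = y"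
  using ldiv_unique by metis

lemma ldiv_mult [simp]: "x \<setminus> (x \<cdot> y) = y"
  using ldiv_unique by metis

lemma rdiv_mult [simp]: "(x \<^bold>/ y) \<cdot> y = x"
  using rdiv_unique by metis

lemma mult_rdiv [simp]: "(x \<cdot> y) \<^bold>/ y = x"
  using rdiv_unique by metis

lemma rdiv_ldiv [simp]: "x \<^bold>/ (y \<setminus> x) = y"
  using mult_ldiv mult_rdiv by metis

lemma ldiv_rdiv [simp]: "(x \<^bold>/ y) \<setminus> x = y"
  using rdiv_mult ldiv_mult by metis

lemma left_cancel: "x \<cdot> y = x \<cdot> z \<longleftrightarrow> y = z"
  using ldiv_mult by metis

lemma right_cancel: "y \<cdot> x = z \<cdot> x \<longleftrightarrow> y = z"
  using mult_rdiv by metis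

end

context middle_bol_loop
begin

definition recip :: "'a \<Rightarrow> 'a" where
  "recip x = x \<setminus> e"

lemma mult_recip [simp]: "x \<cdot> recip x = e"
  by (simp add: recip_def)

lemma recip_mult [simp]: "recip x \<cdot> x = e"
  by (metis inverses_agree recip_def rdiv_mult)

lemma recip_recip [simp]: "recip (recip x) = x"
  by (metis left_cancel mult_recip recip_mult)

text \<open>
  The middle Bol law based at \<open>e\<close>. Inversion is thus an antiautomorphism, and every identity comes
  with a mirror image.
\<close>

lemma recip_prod: "recip (x \<cdot> y) = recip y \<cdot> recip x"
  by (metis inverses_agree left_id middle_bol recip_def)

lemma recip_rdiv: "recip (x \<^bold>/ y) = recip y \<setminus> recip x"
  by (metis ldiv_mult rdiv_mult recip_prod)

lemma rdiv_prod_left: "x \<^bold>/ (x \<cdot> z) = (x \<^bold>/ z) \<^bold>/ x"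
  by (metis ldiv_eq_rdiv mult_ldiv_left mult_rdiv)

lemma middle_bol_right: "(x \<^bold>/ (y \<cdot> z)) \<cdot> x = (x \<^bold>/ z) \<cdot> (y \<setminus> x)"
  by (metis ldiv_eq_rdiv middle_bol)

lemma mult_ldiv_self: "x \<cdot> (z \<setminus> x) = (z \<^bold>/ x) \<setminus> x"
  by (metis ldiv_rdiv rdiv_ldiv rdiv_prod_left)

section \<open>Powers in the associated left Bol loop\<close>

text \<open>
  The product \<open>x \<circ> s = x / s\<^sup>-\<close> makes the same set a left Bol loop. Its power
  laws \<open>x \<circ> (x \<circ> s) = x\<^sup>2 \<circ> s\<close> and \<open>x \<circ> (x\<^sup>2 \<circ> s) = x\<^sup>3 \<circ> s\<close>, for \<open>s = z\<^sup>-\<close>, are \<open>rdiv_square\<close> and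
  \<open>rdiv_cube\<close>. They follow from the middle Bol law at two mutually inverse factors, and at two factors
  whose product is \<open>x\<^sup>-\<close>.
\<close>

lemma rdiv_square: "x \<^bold>/ recip (x \<^bold>/ z) = (x \<cdot> x) \<^bold>/ z"
proof -
  let ?y = "x \<^bold>/ z"
  have "(x \<^bold>/ recip ?y) \<cdot> (?y \<setminus> x) = x \<cdot> ((?y \<cdot> recip ?y) \<setminus> x)"
    by (rule middle_bol[symmetric])
  then have "(x \<^bold>/ recip ?y) \<cdot> z = x \<cdot> (e \<setminus> x)"
    by simp
  then have "(x \<^bold>/ recip ?y) \<cdot> z = x \<cdot> x"
    by (metis left_id ldiv_mult)
  then show ?thesis by (metis mult_rdiv)
qed

text \<open>The mirror image of \<open>rdiv_square\<close>.\<close>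

lemma ldiv_square: "recip (s \<setminus> x) \<setminus> x = s \<setminus> (x \<cdot> x)"
proof -
  let ?t = "recip (s \<setminus> x)"
  have "x \<cdot> ((?t \<cdot> recip ?t) \<setminus> x) = (x \<^bold>/ recip ?t) \<cdot> (?t \<setminus> x)"
    by (rule middle_bol)
  then have "x \<cdot> x = s \<cdot> (?t \<setminus> x)"
    by (metis left_id ldiv_mult mult_recip recip_recip rdiv_ldiv)
  then show ?thesis by (metis ldiv_mult)
qed

lemma rdiv_cube: "x \<^bold>/ recip ((x \<cdot> x) \<^bold>/ z) = ((x \<cdot> x) \<cdot> x) \<^bold>/ z"
proof -
  let ?y1 = "x \<^bold>/ z" and ?y2 = "(x \<cdot> x) \<^bold>/ z"
  have "?y2 = x \<^bold>/ recip ?y1" by (simp add: rdiv_square)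
  then have "?y2 \<cdot> recip ?y1 = x" by simp
  then have "?y1 \<cdot> recip ?y2 = recip x" by (metis recip_prod recip_recip)
  then have "x \<cdot> (recip x \<setminus> x) = (x \<^bold>/ recip ?y2) \<cdot> (?y1 \<setminus> x)"
    by (metis middle_bol)
  then have "x \<cdot> (x \<cdot> x) = (x \<^bold>/ recip ?y2) \<cdot> z"
    by (metis ldiv_rdiv ldiv_inverse recip_def)
  then show ?thesis by (metis cube_alt cube_def mult_rdiv)
qed

text \<open>
  In \<open>z((z x\<^sup>-)\z) = z / x\<^sup>-\<close> the hypothesis says that the inner quotient is \<open>x\<close>. This is the step that
  moves a cancellation law from \<open>x\<^sup>-\<close> to \<open>x\<close> while keeping the element \<open>z\<close>.
\<close>

lemma right_inverse_swap:
  assumes "(z \<cdot> recip x) \<cdot> x = z"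
  shows "(z \<cdot> x) \<cdot> recip x = z"
proof -
  have "z \<cdot> ((z \<cdot> recip x) \<setminus> z) = z \<^bold>/ recip x" by (rule mult_ldiv_left)
  moreover have "(z \<cdot> recip x) \<setminus> z = x" by (metis assms ldiv_mult)
  ultimately show ?thesis by simp
qed

lemma left_inverse_swap:
  assumes "x \<cdot> (recip x \<cdot> z) = z"
  shows "recip x \<cdot> (x \<cdot> z) = z"
  by (metis assms recip_prod recip_recip right_inverse_swap)

section \<open>The criterion for \<open>g\<^sub>2\<close>\<close>

lemma left_step: "x \<^bold>/ z = (x \<^bold>/ (x \<cdot> z)) \<cdot> x"
  by (simp add: rdiv_prod_left)

lemma rdiv_inject: "x \<^bold>/ y = x \<^bold>/ z \<longleftrightarrow> y = z"
  by (metis ldiv_rdiv)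

text \<open>
  Injectivity of \<open>t \<mapsto> x / t\<close> trades a factor \<open>x\<close> on the left of one side of an equation for a factor
  \<open>x\<close> on the right of the quotient of the other side.
\<close>

lemma left_mult_eq_iff: "x \<cdot> t = v \<longleftrightarrow> x \<^bold>/ t = (x \<^bold>/ v) \<cdot> x"
  by (metis left_step rdiv_inject right_cancel)

lemma rdiv_rdiv_eq_iff: "(p \<^bold>/ q) \<^bold>/ r = c \<longleftrightarrow> p \<^bold>/ q = c \<cdot> r"
  by (metis mult_rdiv rdiv_mult)

lemma thrice_left_iff:
  "x \<cdot> (x \<cdot> (x \<cdot> (y \<cdot> x))) = w \<cdot> x \<longleftrightarrow>
    x \<^bold>/ (y \<cdot> x) = (((x \<^bold>/ (w \<cdot> x)) \<cdot> x) \<cdot> x) \<cdot> x"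
  by (simp only: left_mult_eq_iff rdiv_prod_left rdiv_rdiv_eq_iff)

lemma four_left_iff:
  "x \<cdot> (x \<cdot> (x \<cdot> (x \<cdot> (y \<cdot> x)))) = w \<cdot> x \<longleftrightarrow>
    x \<^bold>/ (y \<cdot> x) = ((((x \<^bold>/ (w \<cdot> x)) \<cdot> x) \<cdot> x) \<cdot> x) \<cdot> x"
  by (simp only: left_mult_eq_iff rdiv_prod_left rdiv_rdiv_eq_iff)

end

section \<open>Middle Bol loops with \<open>x\<^sup>2(x y) = x\<^sup>3 y\<close>\<close>

locale cube_middle_bol_loop = middle_bol_loop +
  assumes cube_prod: "(x \<cdot> x) \<cdot> (x \<cdot> y) = ((x \<cdot> x) \<cdot> x) \<cdot> y"
begin

lemma rdiv_recip_square: "x \<^bold>/ recip (x \<cdot> x) = (x \<cdot> x) \<cdot> x"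
proof -
  have "x \<cdot> recip (x \<cdot> x) = recip x"
    by (metis recip_prod recip_recip rdiv_inverse rdiv_mult recip_def)
  then have "x \<cdot> (recip x \<setminus> x) = x \<^bold>/ recip (x \<cdot> x)"
    by (metis mult_ldiv_left)
  then show ?thesis
    by (metis ldiv_inverse recip_def cube_alt cube_def)
qed

text \<open>
  Both sides of the cube law at \<open>v = (z x)\x\<close> are quotients of \<open>x\<close>, multiplied by \<open>x\<close>: the law
  \<open>(x / (y c))x = (x / c)(y\x)\<close> with \<open>c = x\<^sup>-\<close> or \<open>c = x\<^sup>-\<^sup>2\<close> turns the factors \<open>x\<^sup>2\<close> and \<open>x\<^sup>3\<close> into
  denominators \<open>z x\<^sup>-\<close> and \<open>(z x)x\<^sup>-\<^sup>2\<close>.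
\<close>

lemma prod_recip_square: "(z \<cdot> x) \<cdot> recip (x \<cdot> x) = z \<cdot> recip x"
proof -
  let ?v = "(z \<cdot> x) \<setminus> x"
  have 1: "x \<cdot> ?v = z \<setminus> x"
    by (simp add: mult_ldiv_self)
  have 2: "(x \<cdot> x) \<cdot> (z \<setminus> x) = (x \<^bold>/ (z \<cdot> recip x)) \<cdot> x"
    by (metis middle_bol_right rdiv_inverse recip_def)
  have 3: "((x \<cdot> x) \<cdot> x) \<cdot> ?v = (x \<^bold>/ ((z \<cdot> x) \<cdot> recip (x \<cdot> x))) \<cdot> x"
    by (metis middle_bol_right rdiv_recip_square)
  show ?thesis
    by (metis 1 2 3 cube_prod rdiv_inject right_cancel)
qed

lemma prod_recip_prod_square: "(z \<cdot> recip x) \<cdot> (x \<cdot> x) = z \<cdot> x"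
  using prod_recip_square[of z "recip x"] by (simp add: recip_prod)

lemma square_prod_recip_prod: "(x \<cdot> x) \<cdot> (recip x \<cdot> z) = x \<cdot> z"
  by (metis prod_recip_prod_square recip_prod recip_recip prod_recip_square)

lemma recip_square_prod: "recip (x \<cdot> x) \<cdot> (x \<cdot> z) = recip x \<cdot> z"
  by (metis square_prod_recip_prod recip_prod recip_recip)

text \<open>
  Multiplying by \<open>x\<^sup>2\<close> and then by \<open>x\<^sup>-\<^sup>2\<close> takes \<open>z x\<^sup>-\<close> to \<open>z x\<close> and back, and every element is of the
  form \<open>z x\<^sup>-\<close>.
\<close>

lemma square_right_inverse: "(z \<cdot> (x \<cdot> x)) \<cdot> recip (x \<cdot> x) = z"
  by (metis prod_recip_prod_square prod_recip_square rdiv_mult)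

lemma square_left_inverse: "recip (x \<cdot> x) \<cdot> ((x \<cdot> x) \<cdot> z) = z"
  by (metis square_right_inverse recip_prod recip_recip)

lemma recip_square_right: "(z \<cdot> recip (x \<cdot> x)) \<cdot> (x \<cdot> x) = z"
  by (metis square_right_inverse recip_prod)

lemma recip_square_left: "(x \<cdot> x) \<cdot> (recip (x \<cdot> x) \<cdot> z) = z"
  by (metis square_left_inverse recip_prod)

lemma rdiv_of_square: "z \<^bold>/ (x \<cdot> x) = z \<cdot> recip (x \<cdot> x)"
  by (metis recip_square_right mult_rdiv)

lemma prod_cube: "(z \<cdot> x) \<cdot> (x \<cdot> x) = z \<cdot> ((x \<cdot> x) \<cdot> x)"
proof -
  have "recip ((z \<cdot> x) \<cdot> (x \<cdot> x)) = recip (z \<cdot> ((x \<cdot> x) \<cdot> x))"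
    by (metis cube_alt cube_def cube_prod recip_prod)
  then show ?thesis by (metis recip_recip)
qed

text \<open>
  This is \<open>x\<^sup>- \<circ> (x\<^sup>-\<^sup>2 \<circ> s) = x\<^sup>-\<^sup>3 \<circ> s\<close> (\<open>rdiv_cube\<close>) for \<open>s = u\<^sup>-\<close>, where dividing by the square \<open>u\<close> is
  multiplying by \<open>u\<^sup>-\<close>.
\<close>

lemma rdiv_square_prod_cube:
  assumes u: "u = t \<cdot> t"
  shows "x \<^bold>/ (u \<cdot> ((x \<cdot> x) \<cdot> x)) = recip (x \<cdot> x) \<cdot> recip u"
proof -
  let ?k = "recip x" and ?A = "recip (x \<cdot> x) \<cdot> recip u"
  have kk: "?k \<cdot> ?k = recip (x \<cdot> x)" by (simp add: recip_prod)
  have kkk: "(?k \<cdot> ?k) \<cdot> ?k = recip ((x \<cdot> x) \<cdot> x)"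
    by (metis cube_alt cube_def recip_prod)
  have "?A = (?k \<cdot> ?k) \<^bold>/ u" by (simp add: u rdiv_of_square kk)
  then have "?k \<^bold>/ recip ?A = recip ((x \<cdot> x) \<cdot> x) \<^bold>/ u"
    by (metis rdiv_cube kkk)
  then have "?k \<^bold>/ recip ?A = recip ((x \<cdot> x) \<cdot> x) \<cdot> recip u"
    by (simp add: u rdiv_of_square)
  then have "?k = (recip ((x \<cdot> x) \<cdot> x) \<cdot> recip u) \<cdot> recip ?A"
    by (metis rdiv_mult)
  then have "x = ?A \<cdot> (u \<cdot> ((x \<cdot> x) \<cdot> x))"
    by (metis recip_prod recip_recip)
  then show ?thesis by (metis mult_rdiv)
qed

text \<open>
  For \<open>y = x\<^sup>-\<^sup>2 u\<^sup>-\<close> the element \<open>x(x\<^sup>2 y)\<close> collapses to \<open>x u\<^sup>-\<close>, whose left quotient of \<open>x\<close> is \<open>u\<close>; that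
  of \<open>y\<close> is \<open>u x\<^sup>3\<close> by \<open>rdiv_square_prod_cube\<close>. So (C) says \<open>((u x)x)x = u x\<^sup>3\<close>, which means
  \<open>(z x\<^sup>-)x = z\<close> for \<open>z = u x\<close>.
\<close>

lemma square_left_factor_from_C:
  assumes C: "identity_C (\<cdot>)"
  shows "((t \<cdot> t) \<cdot> x) \<cdot> recip x = t \<cdot> t"
proof -
  define u where "u = t \<cdot> t"
  let ?y = "recip (x \<cdot> x) \<cdot> recip u" and ?z = "u \<cdot> x"
  have "x \<cdot> (x \<cdot> (x \<cdot> (?y \<cdot> x))) = (x \<cdot> ((x \<cdot> x) \<cdot> ?y)) \<cdot> x"
    using C by (simp add: identity_C_def)
  then have "x \<^bold>/ (?y \<cdot> x) = (((x \<^bold>/ ((x \<cdot> recip u) \<cdot> x)) \<cdot> x) \<cdot> x) \<cdot> x"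
    by (simp add: thrice_left_iff recip_square_left)
  then have "?y \<setminus> x = ((((x \<cdot> recip u) \<setminus> x) \<cdot> x) \<cdot> x) \<cdot> x"
    by (metis g2_forms_agree rdiv_mult)
  moreover have "(x \<cdot> recip u) \<setminus> x = u"
    by (metis u_def recip_square_right ldiv_mult)
  moreover have "?y \<setminus> x = u \<cdot> ((x \<cdot> x) \<cdot> x)"
    by (metis u_def rdiv_square_prod_cube ldiv_rdiv)
  ultimately have "(?z \<cdot> x) \<cdot> x = ?z \<cdot> (x \<cdot> x)"
    by (simp add: prod_cube)
  also have "\<dots> = (?z \<^bold>/ recip x) \<cdot> x"
    by (metis prod_recip_prod_square rdiv_mult)
  \<comment> \<open>The hypothesis of \<open>right_inverse_swap\<close> holds for \<open>x\<^sup>-\<close>, since \<open>z x\<close> and \<open>z / x\<^sup>-\<close> agree.\<close>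
  finally have "(?z \<cdot> x) \<cdot> recip x = ?z"
    by (metis right_cancel rdiv_mult)
  then have "(?z \<cdot> recip x) \<cdot> x = ?z"
    using right_inverse_swap[of ?z "recip x"] by simp
  then show ?thesis by (metis right_cancel u_def)
qed

text \<open>
  With \<open>w = u\<^sup>-\<close>, the mirror image of (D) determines \<open>a = x\(x\w)\<close> through \<open>a\x = u x\<^sup>3\<close>, and hence
  \<open>a = x\<^sup>-\<^sup>2 w\<close> by \<open>rdiv_square_prod_cube\<close>. Thus \<open>x\z = x\<^sup>- z\<close> for \<open>z = x\w\<close>, from which
  \<open>left_inverse_swap\<close> gives \<open>x(x\<^sup>- w) = w\<close>, the mirror image of the claim.
\<close>

lemma square_left_factor_from_D:
  assumes D: "identity_D (\<cdot>)"
  shows "((t \<cdot> t) \<cdot> x) \<cdot> recip x = t \<cdot> t"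
proof -
  define u where "u = t \<cdot> t"
  let ?w = "recip u"
  have dual: "(((x \<cdot> y) \<cdot> x) \<cdot> x) \<cdot> x = x \<cdot> (y \<cdot> ((x \<cdot> x) \<cdot> x))" for x y
  proof -
    have "recip (recip x \<cdot> (recip x \<cdot> (recip x \<cdot> (recip y \<cdot> recip x)))) =
      recip (((recip x \<cdot> (recip x \<cdot> recip x)) \<cdot> recip y) \<cdot> recip x)"
      using D by (simp add: identity_D_def)
    then show ?thesis by (simp add: recip_prod)
  qed
  have w: "(x \<cdot> ?w) \<setminus> x = u" for x
    by (metis u_def recip_square_right ldiv_mult)
  let ?A = "x \<setminus> (x \<setminus> ?w)" and ?z = "x \<setminus> ?w"
  have "(x \<^bold>/ (x \<cdot> ?w)) \<cdot> x = x \<cdot> u"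
    by (metis ldiv_eq_rdiv w)
  moreover have "x \<^bold>/ ?A = (((x \<^bold>/ (x \<cdot> ?w)) \<cdot> x) \<cdot> x) \<cdot> x"
    by (metis left_step mult_ldiv)
  ultimately have "(x \<^bold>/ ?A) \<cdot> x = x \<cdot> (u \<cdot> ((x \<cdot> x) \<cdot> x))"
    by (simp add: dual)
  then have "?A \<setminus> x = u \<cdot> ((x \<cdot> x) \<cdot> x)"
    by (metis ldiv_eq_rdiv left_cancel)
  then have "?A = recip (x \<cdot> x) \<cdot> ?w"
    by (metis rdiv_ldiv rdiv_square_prod_cube u_def)
  then have "x \<setminus> ?z = recip x \<cdot> ?z"
    by (metis recip_square_prod mult_ldiv)
  then have "x \<cdot> (recip x \<cdot> ?z) = ?z"
    by (metis mult_ldiv)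
  then have "recip x \<cdot> (x \<cdot> ?z) = ?z"
    by (rule left_inverse_swap)
  then have "x \<cdot> (recip x \<cdot> ?w) = ?w"
    by (metis mult_ldiv)
  then show ?thesis
    by (metis recip_prod recip_recip u_def)
qed

section \<open>Flexibility\<close>

text \<open>
  The assumption below is what (C) and (D) provide. With it, every division of a square, or by a
  square, is a multiplication by an inverse.
\<close>

context
  assumes square_prod_recip: "\<And>t x. ((t \<cdot> t) \<cdot> x) \<cdot> recip x = t \<cdot> t"
begin

lemma recip_prod_square: "recip x \<cdot> (x \<cdot> (t \<cdot> t)) = t \<cdot> t"
proof -
  have "((recip t \<cdot> recip t) \<cdot> recip x) \<cdot> recip (recip x) = recip t \<cdot> recip t"
    by (rule square_prod_recip)
  then have "recip (((recip t \<cdot> recip t) \<cdot> recip x) \<cdot> x) = recip (recip t \<cdot> recip t)"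
    by simp
  then show ?thesis by (simp add: recip_prod)
qed

lemma rdiv_from_square: "(t \<cdot> t) \<^bold>/ z = (t \<cdot> t) \<cdot> recip z"
  using square_prod_recip[of t "recip z"] by (metis recip_recip mult_rdiv)

lemma ldiv_to_square: "z \<setminus> (t \<cdot> t) = recip z \<cdot> (t \<cdot> t)"
  using recip_prod_square[of "recip z" t] by (metis recip_recip ldiv_mult)

lemma square_moufang:
  "((t \<cdot> t) \<cdot> y) \<cdot> (z \<cdot> (t \<cdot> t)) = (t \<cdot> t) \<cdot> ((y \<cdot> z) \<cdot> (t \<cdot> t))"
proof -
  have "(t \<cdot> t) \<cdot> ((recip z \<cdot> recip y) \<setminus> (t \<cdot> t)) =
      ((t \<cdot> t) \<^bold>/ recip y) \<cdot> (recip z \<setminus> (t \<cdot> t))"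
    by (rule middle_bol)
  then show ?thesis
    by (simp add: rdiv_from_square ldiv_to_square recip_prod)
qed

text \<open>
  The last factor is \<open>x = x\<^sup>- x\<^sup>2\<close>, so the Moufang law for the square \<open>x\<^sup>2\<close> rewrites the right-hand
  side to \<open>x\<^sup>2((z x\<^sup>-)x\<^sup>2)\<close>.
\<close>

lemma square_prod_prod: "(x \<cdot> x) \<cdot> (z \<cdot> x) = ((x \<cdot> x) \<cdot> z) \<cdot> x"
proof -
  have "((x \<cdot> x) \<cdot> z) \<cdot> (recip x \<cdot> (x \<cdot> x)) = (x \<cdot> x) \<cdot> ((z \<cdot> recip x) \<cdot> (x \<cdot> x))"
    by (rule square_moufang)
  moreover have "recip x \<cdot> (x \<cdot> x) = x"
    by (metis left_id prod_recip_prod_square)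
  ultimately show ?thesis by (simp add: prod_recip_prod_square)
qed

text \<open>
  For \<open>k = (z t)\<^sup>-\<close> the element \<open>s = k / z\<^sup>-\<close> has inverse \<open>t\<close>, and \<open>ldiv_square\<close> equates \<open>z\k\<close> with
  \<open>s\k\<^sup>2\<close>. As \<open>k\<^sup>2\<close> is a square, the latter is \<open>s\<^sup>- k\<^sup>2\<close>.
\<close>

lemma ldiv_recip_quotient: "z \<setminus> recip (z \<cdot> t) = t \<cdot> recip ((z \<cdot> t) \<cdot> (z \<cdot> t))"
proof -
  let ?k = "recip (z \<cdot> t)"
  let ?s = "?k \<^bold>/ recip z"
  have "z \<setminus> ?k = ?s \<setminus> (?k \<cdot> ?k)"
    using ldiv_square[of ?s ?k] by simp
  also have "\<dots> = recip ?s \<cdot> (?k \<cdot> ?k)"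
    by (rule ldiv_to_square)
  also have "recip ?s = t"
    by (simp add: recip_rdiv)
  finally show ?thesis by (simp add: recip_prod)
qed

text \<open>
  Put \<open>s = r\<^sup>-\<close>, \<open>x = s y\<close> and \<open>q = x\<^sup>- y = (y\<^sup>- r)y\<close>. Since \<open>x y = x\<^sup>2 q\<close>, the product \<open>(x y)q\<close> is
  \<open>x\<^sup>2 q\<^sup>2 = x(x q\<^sup>2)\<close>, where \<open>x q\<^sup>2 = y\<^sup>-\q\<close>. The middle Bol law based at \<open>x y\<close>, followed by the one
  based at \<open>x\<close>, gives \<open>(x y)q = (x / s)(s\x) = x(s\<^sup>2\x)\<close>, where \<open>s\<^sup>2\x = s\<^sup>- y = r y\<close> by the cube law.
  Comparing, \<open>y\<^sup>-(r y) = q\<close>.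
\<close>

lemma recip_flexible: "recip y \<cdot> (r \<cdot> y) = (recip y \<cdot> r) \<cdot> y"
proof -
  define s x q where "s = recip r" and "x = s \<cdot> y" and "q = recip x \<cdot> y"
  have 1: "(x \<cdot> y) \<cdot> q = (x \<cdot> x) \<cdot> (q \<cdot> q)"
  proof -
    have "x \<cdot> y = (x \<cdot> x) \<cdot> q"
      by (simp add: q_def square_prod_recip_prod)
    moreover have "((x \<cdot> x) \<cdot> q) \<cdot> q = (x \<cdot> x) \<cdot> (q \<cdot> q)"
      by (metis prod_recip_prod_square square_prod_recip)
    ultimately show ?thesis by simp
  qed
  have 2: "(x \<cdot> x) \<cdot> (q \<cdot> q) = x \<cdot> (x \<cdot> (q \<cdot> q))"
    by (metis square_prod_recip_prod recip_prod_square)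
  have 3: "x \<cdot> (q \<cdot> q) = recip y \<setminus> q"
  proof -
    have "recip q = recip y \<cdot> x" by (simp add: q_def recip_prod)
    then show ?thesis
      using ldiv_recip_quotient[of "recip y" x] by (metis recip_prod recip_recip)
  qed
  have 4: "(x \<cdot> y) \<cdot> q = x \<cdot> ((s \<cdot> s) \<setminus> x)"
  proof -
    have "(x \<cdot> y) \<cdot> ((x \<cdot> x) \<setminus> (x \<cdot> y)) = ((x \<cdot> y) \<^bold>/ x) \<cdot> (x \<setminus> (x \<cdot> y))"
      by (rule middle_bol)
    moreover have "(x \<cdot> x) \<setminus> (x \<cdot> y) = q"
      by (metis q_def square_prod_recip_prod ldiv_mult)
    moreover have "(x \<cdot> y) \<^bold>/ x = x \<^bold>/ s"
      by (metis ldiv_eq_rdiv mult_rdiv rdiv_ldiv rdiv_mult x_def ldiv_mult ldiv_rdiv)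
    moreover have "x \<setminus> (x \<cdot> y) = s \<setminus> x"
      by (simp add: x_def)
    moreover have "(x \<^bold>/ s) \<cdot> (s \<setminus> x) = x \<cdot> ((s \<cdot> s) \<setminus> x)"
      by (rule middle_bol[symmetric])
    ultimately show ?thesis by metis
  qed
  have "recip y \<setminus> q = (s \<cdot> s) \<setminus> x"
    using 1 2 3 4 by (metis left_cancel)
  moreover have "(s \<cdot> s) \<setminus> x = r \<cdot> y"
    by (metis s_def x_def recip_recip square_prod_recip_prod ldiv_mult)
  ultimately have "recip y \<cdot> (r \<cdot> y) = q"
    by (metis mult_ldiv)
  then show ?thesis
    by (simp add: q_def x_def s_def recip_prod)
qed

text \<open>
  Both factors on the left of \<open>z\<close> in \<open>x = x\<^sup>2 x\<^sup>-\<close> commute with right multiplication by \<open>x\<close>, by the two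
  preceding facts on \<open>x\<^sup>2\<close> and \<open>x\<^sup>-\<close>, and the cube law composes them.
\<close>

lemma flexible: "x \<cdot> (z \<cdot> x) = (x \<cdot> z) \<cdot> x"
proof -
  have "x \<cdot> (z \<cdot> x) = (x \<cdot> x) \<cdot> (recip x \<cdot> (z \<cdot> x))"
    by (simp add: square_prod_recip_prod)
  also have "\<dots> = ((x \<cdot> x) \<cdot> (recip x \<cdot> z)) \<cdot> x"
    by (simp add: recip_flexible square_prod_prod)
  finally show ?thesis by (simp add: square_prod_recip_prod)
qed

end

text \<open>
  By flexibility the common left-hand side of (C) and (D) is \<open>(x(x(x z)))x\<close>. Cancelling the outer
  factors leaves \<open>x(x z) = x\<^sup>2 z\<close> in the case of (C), and \<open>x(x(x z)) = x\<^sup>2(x z)\<close> in the case of (D),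
  where \<open>x z\<close> is arbitrary.
\<close>

lemma left_alternative:
  assumes "identity_C (\<cdot>) \<or> identity_D (\<cdot>)"
  shows "x \<cdot> (x \<cdot> y) = (x \<cdot> x) \<cdot> y"
proof -
  have flex: "x \<cdot> (z \<cdot> x) = (x \<cdot> z) \<cdot> x" for x z
    using assms flexible square_left_factor_from_C square_left_factor_from_D by metis
  then have A: "x \<cdot> (x \<cdot> (x \<cdot> (z \<cdot> x))) = (x \<cdot> (x \<cdot> (x \<cdot> z))) \<cdot> x" for z
    by simp
  from assms show ?thesis
  proof
    assume "identity_C (\<cdot>)"
    then show ?thesis
      by (metis A identity_C_def left_cancel right_cancel)
  next
    assume "identity_D (\<cdot>)"
    then have "x \<cdot> (x \<cdot> (x \<cdot> z)) = (x \<cdot> x) \<cdot> (x \<cdot> z)" for z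
      by (metis A identity_D_def cube_prod cube_alt cube_def right_cancel)
    then show ?thesis by (metis mult_ldiv)
  qed
qed

end

section \<open>The equivalences\<close>

theorem theorem2p8:
  fixes mult :: "'a \<Rightarrow> 'a \<Rightarrow> 'a"  (infixl \<open>\<cdot>\<close> 70)
    and e :: 'a
    and ldiv :: "'a \<Rightarrow> 'a \<Rightarrow> 'a"  (infixl \<open>\<setminus>\<close> 70)
    and rdiv :: "'a \<Rightarrow> 'a \<Rightarrow> 'a"  (infixl \<open>\<^bold>'/\<close> 70)
    and g2 :: "'a \<Rightarrow> 'a \<Rightarrow> 'a"
  assumes Q: "middle_bol_loop (\<cdot>) e (\<setminus>) (\<^bold>/)"
    and g2: "(\<forall>x y. g2 x y = x \<^bold>/ (y \<cdot> x)) \<or> (\<forall>x y. g2 x y = (y \<setminus> x) \<^bold>/ x)"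
  shows
    "(identity_A (\<cdot>) \<longleftrightarrow>
        (\<forall>x y. g2 x y = ((g2 x (x \<cdot> (x \<cdot> (x \<cdot> y))) \<cdot> x) \<cdot> x) \<cdot> x))
   \<and> (identity_B (\<cdot>) \<longleftrightarrow>
        (\<forall>x y. g2 x y = ((g2 x ((x \<cdot> x) \<cdot> (x \<cdot> y)) \<cdot> x) \<cdot> x) \<cdot> x))
   \<and> (identity_C (\<cdot>) \<longleftrightarrow>
        (\<forall>x y. g2 x y = ((g2 x (x \<cdot> ((x \<cdot> x) \<cdot> y)) \<cdot> x) \<cdot> x) \<cdot> x))
   \<and> ((identity_D (\<cdot>) \<longleftrightarrow> identity_E (\<cdot>))
      \<and> (identity_E (\<cdot>) \<longleftrightarrow> identity_D' (\<cdot>))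
      \<and> (identity_D' (\<cdot>) \<longleftrightarrow>
          (\<forall>x y. g2 x y = ((g2 x (cube (\<cdot>) x \<cdot> y) \<cdot> x) \<cdot> x) \<cdot> x)))
   \<and> ((\<forall>x y. x \<cdot> (x \<cdot> y) = (x \<cdot> x) \<cdot> y) \<longrightarrow>
        (identity_A (\<cdot>) \<longleftrightarrow> identity_B (\<cdot>)) \<and>
        (identity_B (\<cdot>) \<longleftrightarrow> identity_C (\<cdot>)))
   \<and> ((\<forall>x y. x \<cdot> ((x \<cdot> x) \<cdot> y) = (x \<cdot> (x \<cdot> x)) \<cdot> y) \<longrightarrow>
        (identity_C (\<cdot>) \<longleftrightarrow> identity_D (\<cdot>)) \<and>
        (identity_D (\<cdot>) \<longleftrightarrow> identity_E (\<cdot>)))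
   \<and> ((\<forall>x y. (x \<cdot> x) \<cdot> (x \<cdot> y) = ((x \<cdot> x) \<cdot> x) \<cdot> y) \<longrightarrow>
        (identity_B (\<cdot>) \<longleftrightarrow> identity_C (\<cdot>)) \<and>
        (identity_C (\<cdot>) \<longleftrightarrow> identity_D (\<cdot>)))
   \<and> ((\<forall>x y. x \<cdot> (x \<cdot> y) = (x \<cdot> x) \<cdot> y) \<and>
      (\<forall>x y. x \<cdot> ((x \<cdot> x) \<cdot> y) = (x \<cdot> (x \<cdot> x)) \<cdot> y) \<and>
      (\<forall>x y. (x \<cdot> x) \<cdot> (x \<cdot> y) = ((x \<cdot> x) \<cdot> x) \<cdot> y) \<longrightarrow>
        (identity_A (\<cdot>) \<longleftrightarrow> identity_B (\<cdot>)) \<and>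
        (identity_B (\<cdot>) \<longleftrightarrow> identity_C (\<cdot>)) \<and>
        (identity_C (\<cdot>) \<longleftrightarrow> identity_D (\<cdot>)) \<and>
        (identity_D (\<cdot>) \<longleftrightarrow> identity_E (\<cdot>)) \<and>
        (identity_E (\<cdot>) \<longleftrightarrow>
          (\<forall>x y. cube (\<cdot>) x \<cdot> (y \<cdot> x) = (cube (\<cdot>) x \<cdot> y) \<cdot> x)))
   \<and> ((\<forall>x y. x \<cdot> (x \<cdot> (x \<cdot> (x \<cdot> (y \<cdot> x)))) = (x \<cdot> (x \<cdot> (x \<cdot> (x \<cdot> y)))) \<cdot> x) \<longleftrightarrow>
        (\<forall>x y. g2 x y = (((g2 x (x \<cdot> (x \<cdot> (x \<cdot> (x \<cdot> y)))) \<cdot> x) \<cdot> x) \<cdot> x) \<cdot> x))"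
proof -
  interpret middle_bol_loop mult e ldiv rdiv by (rule Q)
  have g: "g2 x y = x \<^bold>/ (y \<cdot> x)" for x y
    using g2 g2_forms_agree by metis
  have DE: "identity_D (\<cdot>) \<longleftrightarrow> identity_E (\<cdot>)"
    and ED': "identity_E (\<cdot>) \<longleftrightarrow> identity_D' (\<cdot>)"
    using cube_alt by (simp_all add: identity_D_def identity_E_def identity_D'_def cube_def)
  have p1: "identity_A (\<cdot>) \<longleftrightarrow>
      (\<forall>x y. g2 x y = ((g2 x (x \<cdot> (x \<cdot> (x \<cdot> y))) \<cdot> x) \<cdot> x) \<cdot> x)"
    by (simp add: identity_A_def g thrice_left_iff)
  have p2: "identity_B (\<cdot>) \<longleftrightarrow>
      (\<forall>x y. g2 x y = ((g2 x ((x \<cdot> x) \<cdot> (x \<cdot> y)) \<cdot> x) \<cdot> x) \<cdot> x)"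
    by (simp add: identity_B_def g thrice_left_iff)
  have p3: "identity_C (\<cdot>) \<longleftrightarrow>
      (\<forall>x y. g2 x y = ((g2 x (x \<cdot> ((x \<cdot> x) \<cdot> y)) \<cdot> x) \<cdot> x) \<cdot> x)"
    by (simp add: identity_C_def g thrice_left_iff)
  have p4: "identity_D' (\<cdot>) \<longleftrightarrow>
      (\<forall>x y. g2 x y = ((g2 x (cube (\<cdot>) x \<cdot> y) \<cdot> x) \<cdot> x) \<cdot> x)"
    by (simp add: identity_D'_def g thrice_left_iff)
  have p9: "(\<forall>x y. x \<cdot> (x \<cdot> (x \<cdot> (x \<cdot> (y \<cdot> x)))) = (x \<cdot> (x \<cdot> (x \<cdot> (x \<cdot> y)))) \<cdot> x) \<longleftrightarrow>
      (\<forall>x y. g2 x y = (((g2 x (x \<cdot> (x \<cdot> (x \<cdot> (x \<cdot> y)))) \<cdot> x) \<cdot> x) \<cdot> x) \<cdot> x)"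
    by (simp add: g four_left_iff)
  have p5: "(identity_A (\<cdot>) \<longleftrightarrow> identity_B (\<cdot>)) \<and> (identity_B (\<cdot>) \<longleftrightarrow> identity_C (\<cdot>))"
    if "\<forall>x y. x \<cdot> (x \<cdot> y) = (x \<cdot> x) \<cdot> y"
  proof -
    have e1: "x \<cdot> (x \<cdot> (x \<cdot> y)) = (x \<cdot> x) \<cdot> (x \<cdot> y)" for x y
      using that by metis
    have e2: "x \<cdot> ((x \<cdot> x) \<cdot> y) = (x \<cdot> x) \<cdot> (x \<cdot> y)" for x y
      using that by metis
    show ?thesis
      by (simp only: identity_A_def identity_B_def identity_C_def e1 e2)
  qed
  have p6: "identity_C (\<cdot>) \<longleftrightarrow> identity_D (\<cdot>)"
    if "\<forall>x y. x \<cdot> ((x \<cdot> x) \<cdot> y) = (x \<cdot> (x \<cdot> x)) \<cdot> y"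
    using that by (simp add: identity_C_def identity_D_def)
  \<comment> \<open>(B) and (D) have the same right-hand side; (C) enters through the left alternative law.\<close>
  have p7: "(identity_B (\<cdot>) \<longleftrightarrow> identity_C (\<cdot>)) \<and> (identity_C (\<cdot>) \<longleftrightarrow> identity_D (\<cdot>))"
    if H: "\<forall>x y. (x \<cdot> x) \<cdot> (x \<cdot> y) = ((x \<cdot> x) \<cdot> x) \<cdot> y"
  proof -
    interpret cube_middle_bol_loop mult e ldiv rdiv
      by unfold_locales (use H in blast)
    have BD: "identity_B (\<cdot>) \<longleftrightarrow> identity_D (\<cdot>)"
      using H by (simp add: DE identity_B_def identity_E_def)
    have "identity_B (\<cdot>) \<longleftrightarrow> identity_C (\<cdot>)" if "identity_C (\<cdot>) \<or> identity_D (\<cdot>)"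
      using p5 left_alternative[OF that] by metis
    then show ?thesis using BD by blast
  qed
  have p8: "identity_E (\<cdot>) \<longleftrightarrow> (\<forall>x y. cube (\<cdot>) x \<cdot> (y \<cdot> x) = (cube (\<cdot>) x \<cdot> y) \<cdot> x)"
    if lap: "\<forall>x y. x \<cdot> (x \<cdot> y) = (x \<cdot> x) \<cdot> y"
      and H: "\<forall>x y. (x \<cdot> x) \<cdot> (x \<cdot> y) = ((x \<cdot> x) \<cdot> x) \<cdot> y"
  proof -
    have "x \<cdot> (x \<cdot> (x \<cdot> z)) = ((x \<cdot> x) \<cdot> x) \<cdot> z" for x z
      using lap H by metis
    then show ?thesis by (simp only: identity_E_def cube_def)
  qed
  show ?thesis
    using p1 p2 p3 p4 p5 p6 p7 p8 p9 DE ED' by blast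
qed

end
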